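(* Let $\Omega$ be a non-empty finite set with $n$ elements, let $\overline{p}\colon\Omega\to[0,1]$ be an upper probability mass function whose associated lower prevision $\underline{P}_{\overline{p}}$ avoids sure loss, and let $f\colon\Omega\to\mathbb{R}$ be a gamble. Write $$f=\sum_{i=0}^{m}\lambda_i I_{A_i},$$ where $\Omega=A_0\supsetneq A_1\supsetneq\dots\supsetneq A_m\supsetneq\emptyset$ are the level sets of $f$, $\lambda_0\in\mathbb{R}$ and $\lambda_1,\dots,\lambda_m>0$. For $\omega\in\Omega$ let $A_\omega:=\bigcap_{0\le i\le m,\ \omega\in A_i}A_i$ be the smallest level set containing $\omega$, and order the elements of $\Omega$ as $\omega_1,\dots,\omega_n$ such that $A_{\omega_i}\subseteq A_{\omega_j}$ for all $i\le j$. Let $k$ be the smallest index such that $\sum_{j=1}^{k}\overline{p}(\omega_j)\ge 1$ (such $k$ exists because $\underline{P}_{\overline{p}}$ avoids sure loss), and define $$p(\omega_i):=\begin{cases}\overline{p}(\omega_i) & \text{if } i<k,\\ 1-\sum_{j=1}^{i-1}\overline{p}(\omega_j) & \text{if } i=k,\\ 0 & \text{if } i>k.\end{cases}$$ Then $0\le p(\omega)\le\overline{p}(\omega)$ for all $\omega\in\Omega$, $\sum_{\omega\in\Omega}p(\omega)=1$, and $$\overline{E}_{\overline{p}}(f)=E_p(f):=\sum_{\omega\in\Omega}f(\omega)p(\omega).$$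
   Context: A gamble is a real-valued function on the finite set $\Omega$; $I_A$ denotes the indicator function of $A\subseteq\Omega$. Inequalities between gambles are pointwise, and constants are identified with constant gambles. An upper probability mass function $\overline{p}\colon\Omega\to[0,1]$ represents the lower prevision $\underline{P}_{\overline{p}}$ with domain $\{-I_{\{\omega\}}\colon\omega\in\Omega\}$ given by $\underline{P}_{\overline{p}}(-I_{\{\omega\}}):=-\overline{p}(\omega)$. A lower prevision $\underline{P}$ (a real-valued function on a set $\operatorname{dom}\underline{P}$ of gambles) avoids sure loss if for all $N\in\mathbb{N}$, all $\mu_1,\dots,\mu_N\ge0$ and all $f_1,\dots,f_N\in\operatorname{dom}\underline{P}$ one has $\max_{\omega\in\Omega}\sum_{i=1}^{N}\mu_i[f_i(\omega)-\underline{P}(f_i)]\ge0$. (For $\underline{P}_{\overline{p}}$ this is known to be equivalent to $\sum_{\omega\in\Omega}\overline{p}(\omega)\ge1$.) The natural extension of $\underline{P}_{\overline{p}}$ is $\underline{E}_{\overline{p}}(f):=\sup\{\alpha\in\mathbb{R}\colon f-\alpha\ge\sum_{i=1}^{N}\mu_i(f_i-\underline{P}_{\overline{p}}(f_i)),\ N\in\mathbb{N},\ f_i\in\operatorname{dom}\underline{P}_{\overline{p}},\ \mu_i\ge0\}$, and its conjugate, the upper natural extension, is $\overline{E}_{\overline{p}}(f):=-\underline{E}_{\overline{p}}(-f)$. Explicitly, $\overline{E}_{\overline{p}}(f)=\inf\{\beta\in\mathbb{R}\colon \beta-f\ge\sum_{\omega\in\Omega}\mu_\omega(\overline{p}(\omega)-I_{\{\omega\}})\text{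 for some }\mu_\omega\ge0\}$. *)

theory Defs
  imports "HOL-Analysis.Analysis"
begin

text \<open>
  The possibility space is a type of class \<open>finite\<close>, hence non-empty and finite.
\<close>

type_synonym 'a gamble = "'a \<Rightarrow> real"

text \<open>
  A lower prevision is a real-valued function on an arbitrary set of gambles, so it is
  modelled as a partial function, with \<open>dom\<close> as its domain.
\<close>

type_synonym 'a lower_prevision = "'a gamble \<rightharpoonup> real"

definition avoids_sure_loss :: "'a::finite lower_prevision \<Rightarrow> bool" where
  "avoids_sure_loss P \<longleftrightarrow>
     (\<forall>(N::nat) (\<mu>::nat \<Rightarrow> real) (g::nat \<Rightarrow> 'a gamble).
        (\<forall>i\<in>{1..N}. 0 \<le> \<mu> i \<and> g i \<in> dom P) \<longrightarrow>
        0 \<le> Max (range (\<lambda>x. \<Sum>i=1..N. \<mu> i * (g i x - the (P (g i))))))"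

definition acceptable_prices :: "'a::finite lower_prevision \<Rightarrow> 'a gamble \<Rightarrow> real set" where
  "acceptable_prices P f =
     {\<alpha>. \<exists>(N::nat) (\<mu>::nat \<Rightarrow> real) (g::nat \<Rightarrow> 'a gamble).
        (\<forall>i\<in>{1..N}. 0 \<le> \<mu> i \<and> g i \<in> dom P) \<and>
        (\<forall>x. f x - \<alpha> \<ge> (\<Sum>i=1..N. \<mu> i * (g i x - the (P (g i)))))}"

text \<open>
  The supremum is taken in the reals. It is meaningful whenever \<open>P\<close> avoids sure loss, see
  \<open>acceptable_prices_nonempty\<close> and \<open>acceptable_prices_bdd_above\<close> below.
\<close>

definition natural_extension :: "'a::finite lower_prevision \<Rightarrow> 'a gamble \<Rightarrow> real" where
  "natural_extension P f = Sup (acceptable_prices P f)"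

definition upper_natural_extension :: "'a::finite lower_prevision \<Rightarrow> 'a gamble \<Rightarrow> real" where
  "upper_natural_extension P f = - natural_extension P (\<lambda>x. - f x)"

definition neg_singleton :: "'a \<Rightarrow> 'a gamble" where
  "neg_singleton w = (\<lambda>x. - indicator {w} x)"

definition upper_pmf :: "('a::finite \<Rightarrow> real) \<Rightarrow> bool" where
  "upper_pmf pu \<longleftrightarrow> (\<forall>x. 0 \<le> pu x \<and> pu x \<le> 1)"

text \<open>
  As \<open>neg_singleton\<close> is injective, the following assigns \<open>- pu w\<close> to \<open>neg_singleton w\<close>;
  see \<open>dom_pmf_lower_prevision\<close> and \<open>pmf_lower_prevision_neg_singleton\<close>.
\<close>

definition pmf_lower_prevision :: "('a::finite \<Rightarrow> real) \<Rightarrow> 'a lower_prevision" where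
  "pmf_lower_prevision pu g =
     (if g \<in> range neg_singleton then Some (- pu (THE w. g = neg_singleton w)) else None)"

definition expectation :: "('a::finite \<Rightarrow> real) \<Rightarrow> 'a gamble \<Rightarrow> real" where
  "expectation p f = (\<Sum>x\<in>UNIV. f x * p x)"

text \<open>
  The conditions below force \<open>A 0, \<dots>, A m\<close> to be exactly the non-empty sets of the form
  \<open>{x. t \<le> f x}\<close>, see \<open>level_set_decomposition_level_sets\<close>.
\<close>

definition level_set_decomposition ::
    "'a::finite gamble \<Rightarrow> nat \<Rightarrow> (nat \<Rightarrow> 'a set) \<Rightarrow> (nat \<Rightarrow> real) \<Rightarrow> bool" where
  "level_set_decomposition f m A l \<longleftrightarrow>
     A 0 = UNIV \<and> (\<forall>i<m. A (Suc i) \<subset> A i) \<and> A m \<noteq> {} \<and>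
     (\<forall>i\<in>{1..m}. 0 < l i) \<and>
     f = (\<lambda>x. \<Sum>i=0..m. l i * indicator (A i) x)"

definition smallest_level_set :: "nat \<Rightarrow> (nat \<Rightarrow> 'a set) \<Rightarrow> 'a \<Rightarrow> 'a set" where
  "smallest_level_set m A x = \<Inter> {A i | i. i \<le> m \<and> x \<in> A i}"

lemma inj_neg_singleton: "inj neg_singleton"
proof (rule injI)
  fix v w :: 'a
  assume "neg_singleton v = neg_singleton w"
  then have "neg_singleton v v = neg_singleton w v" by simp
  then show "v = w" by (auto simp: neg_singleton_def indicator_def split: if_splits)
qed

lemma dom_pmf_lower_prevision: "dom (pmf_lower_prevision pu) = range neg_singleton"
  by (auto simp: pmf_lower_prevision_def dom_def)

lemma pmf_lower_prevision_neg_singleton: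
  "pmf_lower_prevision pu (neg_singleton w) = Some (- pu w)"
proof -
  have "(THE v. neg_singleton w = neg_singleton v) = w"
    by (rule the_equality) (auto dest: injD[OF inj_neg_singleton])
  then show ?thesis by (simp add: pmf_lower_prevision_def)
qed

lemma acceptable_prices_nonempty: "acceptable_prices P f \<noteq> {}"
proof -
  have "Min (range f) \<in> acceptable_prices P f"
    unfolding acceptable_prices_def by (auto intro!: exI[of _ 0])
  then show ?thesis by blast
qed

lemma acceptable_prices_bdd_above:
  assumes "avoids_sure_loss P"
  shows "bdd_above (acceptable_prices P f)"
proof (rule bdd_aboveI)
  fix \<alpha> assume "\<alpha> \<in> acceptable_prices P f"
  then obtain N \<mu> g where g: "\<forall>i\<in>{1..N::nat}. 0 \<le> \<mu> i \<and> g i \<in> dom P"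
    and le: "\<And>x. f x - \<alpha> \<ge> (\<Sum>i=1..N. \<mu> i * (g i x - the (P (g i))))"
    unfolding acceptable_prices_def by blast
  let ?h = "\<lambda>x. \<Sum>i=1..N. \<mu> i * (g i x - the (P (g i)))"
  have "0 \<le> Max (range ?h)"
    using assms g unfolding avoids_sure_loss_def by blast
  moreover have "Max (range ?h) \<in> range ?h" by (rule Max_in) auto
  ultimately have "\<exists>x. 0 \<le> ?h x" by (metis (no_types, lifting) imageE)
  then obtain x where "0 \<le> ?h x" ..
  with le[of x] have "\<alpha> \<le> f x" by linarith
  also have "f x \<le> Max (range f)" by simp
  finally show "\<alpha> \<le> Max (range f)" .
qed

lemma level_set_decomposition_antimono:
  assumes "level_set_decomposition f m A l" "i \<le> j" "j \<le> m"
  shows "A j \<subseteq> A i"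
  using assms(2,3)
proof (induction j rule: dec_induct)
  case (step j)
  then have "A (Suc j) \<subset> A j"
    using assms(1) unfolding level_set_decomposition_def by simp
  moreover have "A j \<subseteq> A i" using step by simp
  ultimately show ?case by blast
qed simp

lemma level_set_decomposition_value:
  assumes "level_set_decomposition f m A l" "j \<le> m" "x \<in> A j" "j < m \<Longrightarrow> x \<notin> A (Suc j)"
  shows "f x = sum l {0..j}"
proof -
  have "f x = (\<Sum>i=0..m. l i * indicator (A i) x)"
    using assms(1) unfolding level_set_decomposition_def by metis
  also have "\<dots> = (\<Sum>i=0..j. l i * indicator (A i) x)"
  proof (rule sum.mono_neutral_right)
    show "\<forall>i\<in>{0..m} - {0..j}. l i * indicator (A i) x = 0"
    proof
      fix i assume "i \<in> {0..m} - {0..j}"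
      then have "Suc j \<le> i" "i \<le> m" "j < m" by auto
      then have "x \<notin> A i"
        using level_set_decomposition_antimono[OF assms(1), of "Suc j" i] assms(4) by blast
      then show "l i * indicator (A i) x = 0" by simp
    qed
  qed (use assms(2) in auto)
  also have "\<dots> = sum l {0..j}"
  proof (rule sum.cong)
    fix i assume "i \<in> {0..j}"
    then have "x \<in> A i"
      using level_set_decomposition_antimono[OF assms(1), of i j] assms(2,3) by auto
    then show "l i * indicator (A i) x = l i" by simp
  qed simp
  finally show ?thesis .
qed

lemma level_set_decomposition_rank:
  assumes "level_set_decomposition f m A l"
  obtains j where "j \<le> m" "x \<in> A j" "j < m \<Longrightarrow> x \<notin> A (Suc j)"
proof -
  let ?S = "{j. j \<le> m \<and> x \<in> A j}"
  have fin: "finite ?S" by simp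
  have "0 \<in> ?S" using assms unfolding level_set_decomposition_def by simp
  then have "?S \<noteq> {}" by blast
  then have j: "Max ?S \<in> ?S" using fin Max_in by blast
  have "x \<notin> A (Suc (Max ?S))" if "Max ?S < m"
  proof
    assume "x \<in> A (Suc (Max ?S))"
    with that have "Suc (Max ?S) \<in> ?S" by simp
    then have "Suc (Max ?S) \<le> Max ?S" using fin Max_ge by blast
    then show False by simp
  qed
  with j show thesis using that by blast
qed

lemma level_set_decomposition_sum_le_iff:
  assumes "level_set_decomposition f m A l" "i \<le> m" "j \<le> m"
  shows "sum l {0..i} \<le> sum l {0..j} \<longleftrightarrow> i \<le> j"
proof -
  have less: "sum l {0..a} < sum l {0..b}" if "a < b" "b \<le> m" for a b
  proof -
    have pos: "0 < l c" if "a < c" "c \<le> b" for c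
      using that \<open>b \<le> m\<close> assms(1) unfolding level_set_decomposition_def by simp
    have "{0..b} = {0..a} \<union> {a<..b}" "{0..a} \<inter> {a<..b} = {}" using that(1) by auto
    then have "sum l {0..b} = sum l {0..a} + sum l {a<..b}"
      by (simp add: sum.union_disjoint)
    moreover have "0 < sum l {a<..b}"
      by (rule sum_pos) (use pos that(1) in auto)
    ultimately show ?thesis by simp
  qed
  show ?thesis
    using less[of i j] less[of j i] assms(2,3) by (cases i j rule: linorder_cases) auto
qed

lemma level_set_decomposition_eq:
  assumes D: "level_set_decomposition f m A l" and i: "i \<le> m"
  shows "A i = {x. sum l {0..i} \<le> f x}"
proof -
  have "x \<in> A i \<longleftrightarrow> sum l {0..i} \<le> f x" for x
  proof -
    obtain j where j: "j \<le> m" "x \<in> A j" "j < m \<Longrightarrow> x \<notin> A (Suc j)"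
      using level_set_decomposition_rank[OF D] by blast
    have "x \<in> A i \<longleftrightarrow> i \<le> j"
    proof
      assume "x \<in> A i"
      show "i \<le> j"
      proof (rule ccontr)
        assume "\<not> i \<le> j"
        then have "A i \<subseteq> A (Suc j)" "j < m"
          using level_set_decomposition_antimono[OF D, of "Suc j" i] i by auto
        then show False using \<open>x \<in> A i\<close> j(3) by blast
      qed
    next
      assume "i \<le> j"
      then show "x \<in> A i"
        using level_set_decomposition_antimono[OF D _ j(1)] j(2) by blast
    qed
    then show ?thesis
      using level_set_decomposition_sum_le_iff[OF D i j(1)]
        level_set_decomposition_value[OF D j] by simp
  qed
  then show ?thesis by blast
qed

lemma level_set_decomposition_level_sets:
  assumes D: "level_set_decomposition f m A l"
  shows "A ` {0..m} = {{x. t \<le> f x} | t. True} - {{}}"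
proof (intro equalityI subsetI)
  fix B assume "B \<in> A ` {0..m}"
  then obtain i where i: "i \<le> m" "B = A i" by auto
  have "A m \<noteq> {}" using D unfolding level_set_decomposition_def by blast
  then have "B \<noteq> {}"
    using level_set_decomposition_antimono[OF D i(1)] i(2) by auto
  then show "B \<in> {{x. t \<le> f x} | t. True} - {{}}"
    using level_set_decomposition_eq[OF D i(1)] i(2) by blast
next
  fix B assume "B \<in> {{x. t \<le> f x} | t. True} - {{}}"
  then obtain t where t: "B = {x. t \<le> f x}" "B \<noteq> {}" by blast
  have fin: "finite (f ` B)" by simp
  have ne: "f ` B \<noteq> {}" using t(2) by simp
  have "Min (f ` B) \<in> f ` B" using fin ne by (rule Min_in)
  then obtain y where y: "y \<in> B" "f y = Min (f ` B)" by force
  have Beq: "B = {x. f y \<le> f x}"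
  proof (intro equalityI subsetI)
    fix x assume "x \<in> B"
    then show "x \<in> {x. f y \<le> f x}" using y(2) fin by simp
  next
    fix x assume "x \<in> {x. f y \<le> f x}"
    then show "x \<in> B" using y(1) t(1) by auto
  qed
  obtain j where j: "j \<le> m" "y \<in> A j" "j < m \<Longrightarrow> y \<notin> A (Suc j)"
    using level_set_decomposition_rank[OF D] by blast
  have "B = A j"
    using Beq level_set_decomposition_eq[OF D j(1)] level_set_decomposition_value[OF D j] by simp
  then show "B \<in> A ` {0..m}" using j(1) by simp
qed

lemma level_set_decomposition_exists:
  fixes f :: "'a::finite gamble"
  shows "\<exists>m A l. level_set_decomposition f m A l"
proof -
  define xs where "xs = sorted_list_of_set (range f)"
  define m where "m = length xs - 1"
  define A where "A i = {x. xs ! i \<le> f x}" for i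
  define l where "l i = (if i = 0 then xs ! 0 else xs ! i - xs ! (i - 1))" for i
  have set: "set xs = range f" unfolding xs_def by simp
  then have "xs \<noteq> []" by auto
  then have len: "length xs = Suc m" unfolding m_def by simp
  have less: "xs ! i < xs ! j" if "i < j" "j \<le> m" for i j
    using strict_sorted_list_of_set[of "range f"] that len
    unfolding xs_def by (simp add: sorted_wrt_iff_nth_less)
  have le: "xs ! i \<le> xs ! j" if "i \<le> j" "j \<le> m" for i j
    using less[of i j] that by (cases "i = j") auto
  have idx: "\<exists>j\<le>m. f x = xs ! j" for x
  proof -
    have "f x \<in> set xs" using set by simp
    then show ?thesis using len by (auto simp: in_set_conv_nth less_Suc_eq_le)
  qed
  have surj: "\<exists>x. f x = xs ! j" if "j \<le> m" for j
  proof -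
    have "xs ! j \<in> range f" using set len that nth_mem[of j xs] by simp
    then show ?thesis by (metis imageE)
  qed
  have A0: "A 0 = UNIV"
  proof -
    have "xs ! 0 \<le> f x" for x using idx[of x] le[of 0] by auto
    then show ?thesis unfolding A_def by simp
  qed
  have strict: "A (Suc i) \<subset> A i" if "i < m" for i
  proof -
    have lt: "xs ! i < xs ! Suc i" using less that by simp
    obtain x where "f x = xs ! i" using surj[of i] \<open>i < m\<close> by auto
    with lt have "x \<in> A i" "x \<notin> A (Suc i)" unfolding A_def by auto
    moreover have "A (Suc i) \<subseteq> A i" unfolding A_def using lt by auto
    ultimately show ?thesis by blast
  qed
  have ne: "A m \<noteq> {}"
  proof -
    obtain x where "f x = xs ! m" using surj[of m] by auto
    then have "x \<in> A m" unfolding A_def by simp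
    then show ?thesis by blast
  qed
  have pos: "0 < l i" if "i \<in> {1..m}" for i
    using less[of "i - 1" i] that unfolding l_def by auto
  have telescope: "sum l {0..j} = xs ! j" for j
    by (induction j) (simp_all add: l_def)
  have "f x = (\<Sum>i=0..m. l i * indicator (A i) x)" for x
  proof -
    obtain j where j: "j \<le> m" "f x = xs ! j" using idx by blast
    have mem: "x \<in> A i \<longleftrightarrow> i \<le> j" if "i \<le> m" for i
      using less[of j i] le[of i j] j that unfolding A_def by (cases "i \<le> j") auto
    have "(\<Sum>i=0..m. l i * indicator (A i) x) = (\<Sum>i=0..j. l i * indicator (A i) x)"
      by (rule sum.mono_neutral_right) (use j(1) mem in auto)
    also have "\<dots> = sum l {0..j}"
      by (rule sum.cong) (use j(1) mem in auto)
    finally show ?thesis using telescope j(2) by simp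
  qed
  then have "level_set_decomposition f m A l"
    unfolding level_set_decomposition_def using A0 strict ne pos by blast
  then show ?thesis by blast
qed

end

theory Submission
  imports Defs
begin

text \<open>
  Every \<open>p\<close> with \<open>0 \<le> p \<le> pu\<close> and total mass \<open>1\<close> gives \<open>expectation p f\<close> as a lower bound for
  \<open>upper_natural_extension\<close>: take the expectation of the defining inequality. Conversely, the
  multipliers \<open>max 0 (f x - c)\<close> with \<open>c = f (w k)\<close> show that the greedy \<open>p\<close> attains the bound,
  because the order makes \<open>f (w i)\<close> decreasing in \<open>i\<close>, so that \<open>p\<close> equals \<open>pu\<close> where \<open>f > c\<close>
  and vanishes where \<open>f < c\<close> (complementary slackness).
\<close>

text \<open>The last \<open>A j\<close> containing \<open>x\<close> is the superlevel set of
  \<open>f\<close> at height \<open>f x\<close>. Any other \<open>A i\<close> containing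
  \<open>x\<close> is a superlevel set at height at most \<open>f x\<close>, hence includes
  \<open>A j\<close>.\<close>

lemma smallest_level_set_eq:
  assumes D: "level_set_decomposition f m A l"
  shows "smallest_level_set m A x = {y. f x \<le> f y}"
proof -
  obtain j where j: "j \<le> m" "x \<in> A j" "j < m \<Longrightarrow> x \<notin> A (Suc j)"
    using level_set_decomposition_rank[OF D] by blast
  have Aj: "A j = {y. f x \<le> f y}"
    using level_set_decomposition_eq[OF D j(1)] level_set_decomposition_value[OF D j] by simp
  have "A j \<subseteq> A i" if "i \<le> m" "x \<in> A i" for i
    using that level_set_decomposition_eq[OF D that(1)] unfolding Aj by auto
  then have "smallest_level_set m A x = A j"
    unfolding smallest_level_set_def using j(1,2) by blast
  then show ?thesis using Aj by simp
qed

lemma neg_singleton_apply: "neg_singleton y x = (if x = y then - 1 else 0)"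
  by (simp add: neg_singleton_def)

text \<open>Translates combinations indexed by numbers into combinations with one multiplier per
  element, so that multipliers can be given as a function on the possibility space.\<close>

lemma sum_neg_singleton:
  fixes pu \<mu> :: "'a::finite \<Rightarrow> real"
  assumes "bij_betw w I UNIV"
  shows "(\<Sum>i\<in>I. \<mu> (w i) * (neg_singleton (w i) x
            - the (pmf_lower_prevision pu (neg_singleton (w i)))))
         = (\<Sum>y\<in>UNIV. \<mu> y * pu y) - \<mu> x"
proof -
  have "(\<Sum>i\<in>I. \<mu> (w i) * (neg_singleton (w i) x
            - the (pmf_lower_prevision pu (neg_singleton (w i)))))
        = (\<Sum>y\<in>UNIV. \<mu> y * (neg_singleton y x
            - the (pmf_lower_prevision pu (neg_singleton y))))"
    by (rule sum.reindex_bij_betw[OF assms])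
  also have "\<dots> = (\<Sum>y\<in>UNIV. \<mu> y * pu y - (if y = x then \<mu> y else 0))"
    by (rule sum.cong)
      (auto simp: pmf_lower_prevision_neg_singleton neg_singleton_apply algebra_simps)
  also have "\<dots> = (\<Sum>y\<in>UNIV. \<mu> y * pu y) - \<mu> x"
    by (simp add: sum_subtractf)
  finally show ?thesis .
qed

text \<open>Taking each \<open>neg_singleton y\<close> once with multiplier 1 gives a constant
  gamble, the total of \<open>pu\<close> minus 1, whose maximum must be non-negative.\<close>

lemma avoids_sure_loss_sum_ge_1:
  fixes pu :: "'a::finite \<Rightarrow> real"
  assumes "avoids_sure_loss (pmf_lower_prevision pu)"
  shows "1 \<le> (\<Sum>x\<in>UNIV. pu x)"
proof -
  obtain w where w: "bij_betw w {1..CARD('a)} (UNIV :: 'a set)"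
    using ex_bij_betw_nat_finite_1[of "UNIV :: 'a set"] by auto
  let ?h = "\<lambda>x. \<Sum>i=1..CARD('a). 1 * (neg_singleton (w i) x
              - the (pmf_lower_prevision pu (neg_singleton (w i))))"
  have "0 \<le> Max (range ?h)"
    using assms[unfolded avoids_sure_loss_def, rule_format,
        of "CARD('a)" "\<lambda>_. 1" "\<lambda>i. neg_singleton (w i)"]
    by (simp add: dom_pmf_lower_prevision)
  moreover have "?h x = (\<Sum>x\<in>UNIV. pu x) - 1" for x
    using sum_neg_singleton[OF w, of "\<lambda>_. 1"] by simp
  ultimately show ?thesis by simp
qed

lemma acceptable_prices_pmfI:
  fixes pu \<mu> :: "'a::finite \<Rightarrow> real"
  assumes "\<And>x. 0 \<le> \<mu> x"
    and "\<And>x. (\<Sum>y\<in>UNIV. \<mu> y * pu y) - \<mu> x \<le> f x - \<alpha>"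
  shows "\<alpha> \<in> acceptable_prices (pmf_lower_prevision pu) f"
proof -
  obtain w where w: "bij_betw w {1..CARD('a)} (UNIV :: 'a set)"
    using ex_bij_betw_nat_finite_1[of "UNIV :: 'a set"] by auto
  show ?thesis
    unfolding acceptable_prices_def mem_Collect_eq
    by (intro exI[of _ "CARD('a)"] exI[of _ "\<lambda>i. \<mu> (w i)"] exI[of _ "\<lambda>i. neg_singleton (w i)"])
      (use assms in \<open>simp add: sum_neg_singleton[OF w] dom_pmf_lower_prevision del: One_nat_def\<close>)
qed

lemma acceptable_prices_le_expectation:
  fixes pu p :: "'a::finite \<Rightarrow> real"
  assumes p: "\<And>x. 0 \<le> p x" "\<And>x. p x \<le> pu x" "(\<Sum>x\<in>UNIV. p x) = 1"
    and \<alpha>: "\<alpha> \<in> acceptable_prices (pmf_lower_prevision pu) f"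
  shows "\<alpha> \<le> expectation p f"
proof -
  let ?P = "pmf_lower_prevision pu"
  obtain N :: nat and \<mu> g where g: "\<And>i. i \<in> {1..N} \<Longrightarrow> 0 \<le> \<mu> i \<and> g i \<in> dom ?P"
    and le: "\<And>x. (\<Sum>i=1..N. \<mu> i * (g i x - the (?P (g i)))) \<le> f x - \<alpha>"
    using \<alpha> unfolding acceptable_prices_def by blast
  \<comment> \<open>For \<open>h = neg_singleton y\<close> this expectation is
    \<open>pu y - p y\<close>, so domination by \<open>pu\<close> is exactly what makes it
    non-negative.\<close>
  have gain: "0 \<le> (\<Sum>x\<in>UNIV. (h x - the (?P h)) * p x)" if h: "h \<in> dom ?P" for h
  proof -
    obtain y where y: "h = neg_singleton y"
      using h unfolding dom_pmf_lower_prevision by blast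
    have "(\<Sum>x\<in>UNIV. (h x - the (?P h)) * p x)
          = (\<Sum>x\<in>UNIV. pu y * p x - (if x = y then p x else 0))"
      by (rule sum.cong)
        (auto simp: y pmf_lower_prevision_neg_singleton neg_singleton_apply algebra_simps)
    also have "\<dots> = pu y - p y"
      using p(3) by (simp add: sum_subtractf flip: sum_distrib_left)
    finally show ?thesis using p(2)[of y] by simp
  qed
  have "0 \<le> (\<Sum>i=1..N. \<mu> i * (\<Sum>x\<in>UNIV. (g i x - the (?P (g i))) * p x))"
    by (rule sum_nonneg, rule mult_nonneg_nonneg) (use g gain in blast)+
  also have "\<dots> = (\<Sum>x\<in>UNIV. \<Sum>i=1..N. \<mu> i * ((g i x - the (?P (g i))) * p x))"
    unfolding sum_distrib_left by (rule sum.swap)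
  also have "\<dots> = (\<Sum>x\<in>UNIV. (\<Sum>i=1..N. \<mu> i * (g i x - the (?P (g i)))) * p x)"
    by (simp add: sum_distrib_right mult.assoc)
  also have "\<dots> \<le> (\<Sum>x\<in>UNIV. (f x - \<alpha>) * p x)"
    by (intro sum_mono mult_right_mono le p(1))
  also have "\<dots> = expectation p f - \<alpha>"
    using p(3) by (simp add: expectation_def left_diff_distrib sum_subtractf
        flip: sum_distrib_left)
  finally show ?thesis by simp
qed

text \<open>The slackness conditions leave \<open>p\<close> free between 0 and \<open>pu\<close>
  where \<open>f x = c\<close>; this accommodates the partial mass at \<open>w k\<close> and ties
  with \<open>f (w k)\<close>.\<close>

lemma upper_natural_extension_eq_expectation:
  fixes pu p :: "'a::finite \<Rightarrow> real"
  assumes p: "\<And>x. 0 \<le> p x" "\<And>x. p x \<le> pu x" "(\<Sum>x\<in>UNIV. p x) = 1"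
    and slack: "\<And>x. c < f x \<Longrightarrow> p x = pu x" "\<And>x. f x < c \<Longrightarrow> p x = 0"
  shows "upper_natural_extension (pmf_lower_prevision pu) f = expectation p f"
proof -
  have neg: "expectation p (\<lambda>x. - f x) = - expectation p f"
    by (simp add: expectation_def sum_negf)
  have "(\<Sum>x\<in>UNIV. max 0 (f x - c) * pu x) = (\<Sum>x\<in>UNIV. (f x - c) * p x)"
  proof (rule sum.cong)
    show "max 0 (f x - c) * pu x = (f x - c) * p x" for x
      using slack[of x] by (cases "f x" c rule: linorder_cases) auto
  qed simp
  also have "\<dots> = expectation p f - c"
    using p(3) by (simp add: expectation_def left_diff_distrib sum_subtractf
        flip: sum_distrib_left)
  finally have eq: "(\<Sum>x\<in>UNIV. max 0 (f x - c) * pu x) = expectation p f - c" .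
  \<comment> \<open>By \<open>eq\<close>, the inequality to check is
    \<open>f x - c \<le> max 0 (f x - c)\<close>. Hence the supremum is attained.\<close>
  have "- expectation p f \<in> acceptable_prices (pmf_lower_prevision pu) (\<lambda>x. - f x)"
    by (rule acceptable_prices_pmfI[where \<mu> = "\<lambda>x. max 0 (f x - c)"]) (auto simp: eq)
  moreover have "\<alpha> \<le> - expectation p f"
    if "\<alpha> \<in> acceptable_prices (pmf_lower_prevision pu) (\<lambda>x. - f x)" for \<alpha>
    using acceptable_prices_le_expectation[OF p that] neg by simp
  ultimately have "natural_extension (pmf_lower_prevision pu) (\<lambda>x. - f x) = - expectation p f"
    unfolding natural_extension_def by (rule cSup_eq_maximum)
  then show ?thesis by (simp add: upper_natural_extension_def)
qed

theorem theorem7: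
  fixes pu p :: "'a::finite \<Rightarrow> real"
    and f :: "'a gamble"
    and m n k :: nat
    and A :: "nat \<Rightarrow> 'a set"
    and l :: "nat \<Rightarrow> real"
    and w :: "nat \<Rightarrow> 'a"
  assumes n: "n = CARD('a)"
    and pu: "upper_pmf pu"
    and asl: "avoids_sure_loss (pmf_lower_prevision pu)"
    and decomp: "level_set_decomposition f m A l"
    and enum: "bij_betw w {1..n} UNIV"
    and order: "\<And>i j. 1 \<le> i \<Longrightarrow> i \<le> j \<Longrightarrow> j \<le> n \<Longrightarrow>
                  smallest_level_set m A (w i) \<subseteq> smallest_level_set m A (w j)"
    and k: "k = (LEAST k. k \<in> {1..n} \<and> (\<Sum>j=1..k. pu (w j)) \<ge> 1)"
    and p: "\<And>i. i \<in> {1..n} \<Longrightarrow>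
              p (w i) = (if i < k then pu (w i)
                         else if i = k then 1 - (\<Sum>j=1..i-1. pu (w j))
                         else 0)"
  shows "(\<exists>k\<in>{1..n}. (\<Sum>j=1..k. pu (w j)) \<ge> 1) \<and>
         (\<forall>x. 0 \<le> p x \<and> p x \<le> pu x) \<and>
         (\<Sum>x\<in>UNIV. p x) = 1 \<and>
         upper_natural_extension (pmf_lower_prevision pu) f = expectation p f"
proof -
  have pu0: "0 \<le> pu x" for x using pu by (simp add: upper_pmf_def)
  have "1 \<le> n" by (simp add: n Suc_le_eq)
  \<comment> \<open>The index \<open>n\<close> is a candidate, so the least one exists.\<close>
  moreover have "1 \<le> (\<Sum>j=1..n. pu (w j))"
    using avoids_sure_loss_sum_ge_1[OF asl] sum.reindex_bij_betw[OF enum, of pu] by simp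
  ultimately have ex: "\<exists>k. k \<in> {1..n} \<and> (\<Sum>j=1..k. pu (w j)) \<ge> 1" by auto
  have kn: "k \<in> {1..n}" and kge: "(\<Sum>j=1..k. pu (w j)) \<ge> 1"
    using LeastI_ex[OF ex] unfolding k by blast+
  \<comment> \<open>Minimality of \<open>k\<close> applies only when \<open>k - 1\<close> is still
    in \<open>{1..n}\<close>; for \<open>k = 1\<close> the sum is empty.\<close>
  have klt: "(\<Sum>j=1..k-1. pu (w j)) < 1"
  proof (cases "k = 1")
    case False
    with kn have "k - 1 \<in> {1..n}" "k - 1 < k" by auto
    then show ?thesis
      using not_less_Least[of "k - 1" "\<lambda>k. k \<in> {1..n} \<and> (\<Sum>j=1..k. pu (w j)) \<ge> 1"] k
      by force
  qed simp
  have ksplit: "(\<Sum>j=1..k. pu (w j)) = (\<Sum>j=1..k-1. pu (w j)) + pu (w k)"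
    using kn by (cases k) auto
  have surj: "\<exists>i\<in>{1..n}. x = w i" for x
    using bij_betw_imp_surj_on[OF enum] by blast
  \<comment> \<open>The critical index is \<open>k\<close>: \<open>klt\<close> bounds the remaining
    mass from below by 0, and \<open>kge\<close> with \<open>ksplit\<close> bounds it from above by
    \<open>pu (w k)\<close>.\<close>
  have p_bounds: "0 \<le> p x \<and> p x \<le> pu x" for x
    using surj[of x] p pu0 klt kge ksplit by auto
  have p_sum: "(\<Sum>x\<in>UNIV. p x) = 1"
  proof -
    have "(\<Sum>x\<in>UNIV. p x) = (\<Sum>i=1..n. p (w i))"
      by (rule sum.reindex_bij_betw[OF enum, symmetric])
    also have "\<dots> = (\<Sum>i=1..k. p (w i))"
      by (rule sum.mono_neutral_right) (use kn p in auto)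
    also have "\<dots> = (\<Sum>i=1..k-1. p (w i)) + p (w k)"
      using kn by (cases k) auto
    also have "(\<Sum>i=1..k-1. p (w i)) = (\<Sum>i=1..k-1. pu (w i))"
      by (rule sum.cong) (use kn p in auto)
    finally show ?thesis using p[OF kn] by simp
  qed
  \<comment> \<open>Since \<open>w i\<close> lies in its own smallest level set, it lies in that of
    \<open>w j\<close>, the superlevel set at \<open>f (w j)\<close>.\<close>
  have anti: "f (w j) \<le> f (w i)" if "1 \<le> i" "i \<le> j" "j \<le> n" for i j
    using order[OF that] unfolding smallest_level_set_eq[OF decomp] by auto
  have above: "p x = pu x" if less: "f (w k) < f x" for x
  proof -
    obtain i where i: "i \<in> {1..n}" "x = w i" using surj by blast
    \<comment> \<open>Otherwise \<open>k \<le> i\<close>, and \<open>anti\<close> would give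
      \<open>f x \<le> f (w k)\<close>.\<close>
    have "i < k" using anti[of k i] i kn less by (cases "i < k") auto
    then show ?thesis using p[OF i(1)] i(2) by simp
  qed
  have below: "p x = 0" if less: "f x < f (w k)" for x
  proof -
    obtain i where i: "i \<in> {1..n}" "x = w i" using surj by blast
    have "k < i" using anti[of i k] i kn less by (cases "k < i") auto
    then show ?thesis using p[OF i(1)] i(2) by simp
  qed
  have "upper_natural_extension (pmf_lower_prevision pu) f = expectation p f"
    using p_bounds p_sum above below
    by (intro upper_natural_extension_eq_expectation[where c = "f (w k)"]) auto
  then show ?thesis using ex p_bounds p_sum by blast
qed

end
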